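(* Let $d\geq 5$ be an integer. Assume that $\Phi$ is a real equiangular tight frame for $\mathbb{R}^d$ with size $n>d+1$. Then either $n\in\{d+\frac12+\sqrt{2d+\frac14},\ \frac{d(d+1)}{2}\}$, or $$d+\frac12+\sqrt{3d+\frac14}\leq n\leq \frac{d(d+2)}{3}.$$
   Context: A real equiangular tight frame (ETF) for $\mathbb{R}^d$ with size $n>d$ is a set $\Phi=\{\boldsymbol\varphi_i\}_{i=1}^n$ of unit vectors in $\mathbb{R}^d$ whose coherence $\mu(\Phi):=\max_{i\neq j}|\langle\boldsymbol\varphi_i,\boldsymbol\varphi_j\rangle|$ equals the Welch bound $\sqrt{\frac{n-d}{d(n-1)}}$. *)

theory Defs
  imports "HOL-Analysis.Analysis"
begin

text \<open>
  A system of \<open>n\<close> vectors is a family indexed by \<open>{1..n}\<close>; values of \<open>\<phi>\<close> outside this range are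
  irrelevant. The maximum is over a nonempty set exactly when \<open>n \<ge> 2\<close>.
\<close>

definition coherence :: "nat \<Rightarrow> (nat \<Rightarrow> real ^ 'd) \<Rightarrow> real" where
  "coherence n \<phi> = Max {\<bar>\<phi> i \<bullet> \<phi> j\<bar> | i j. i \<in> {1..n} \<and> j \<in> {1..n} \<and> i \<noteq> j}"

definition welch_bound :: "nat \<Rightarrow> nat \<Rightarrow> real" where
  "welch_bound d n = sqrt ((real n - real d) / (real d * (real n - 1)))"

text \<open>
  Distinctness of the vectors is not required separately: for \<open>CARD('d) \<ge> 2\<close> the Welch bound is
  less than \<open>1\<close>, so two equal unit vectors cannot occur.
\<close>

definition real_ETF :: "nat \<Rightarrow> (nat \<Rightarrow> real ^ 'd) \<Rightarrow> bool" where
  "real_ETF n \<phi> \<longleftrightarrow>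
     n > CARD('d) \<and>
     (\<forall>i\<in>{1..n}. norm (\<phi> i) = 1) \<and>
     coherence n \<phi> = welch_bound CARD('d) n"

end

theory Submission
  imports Defs
begin

text \<open>
  Equality in the Welch bound forces the frame to be equiangular and tight, so \<open>d / n\<close> times the
  Gram matrix is an orthogonal projection \<open>P\<close> of trace \<open>r = d\<close> with constant diagonal and
  off-diagonal entries of constant modulus; the same holds for \<open>1 - P\<close> with \<open>r = n - d\<close>.
  For such a projection put \<open>A = r (n - 1) / (n - r)\<close>, the inverse square of its coherence. The
  sign matrix of \<open>P\<close> is integral with two rational eigenvalues unless \<open>n = 2 r\<close>, so \<open>A\<close> is
  an integer, and \<open>A > r\<close>. The value \<open>A = r + 1\<close> means \<open>n = r\<^sup>2\<close>, which contradicts the fourth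
  order Welch inequality; \<open>A = r + 2\<close> means \<open>n = r (r + 1) / 2\<close>; and \<open>A \<ge> r + 3\<close> gives
  \<open>n \<le> r (r + 2) / 3\<close>. For \<open>r = d\<close> this is the upper half of the claim, and for \<open>r = n - d\<close> the lower half.
\<close>

section \<open>Orthogonal projections as symmetric idempotent kernels\<close>

definition projection_kernel :: "'a set \<Rightarrow> ('a \<Rightarrow> 'a \<Rightarrow> real) \<Rightarrow> bool" where
  "projection_kernel I P \<longleftrightarrow>
     (\<forall>i\<in>I. \<forall>j\<in>I. P i j = P j i \<and> (\<Sum>k\<in>I. P i k * P k j) = P i j)"

lemma projection_kernel_sym: "projection_kernel I P \<Longrightarrow> i \<in> I \<Longrightarrow> j \<in> I \<Longrightarrow> P i j = P j i"
  by (auto simp: projection_kernel_def)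

lemma projection_kernel_mult:
  assumes "projection_kernel I P" "i \<in> I" "j \<in> I"
  shows "(\<Sum>k\<in>I. P i k * P k j) = P i j"
    and "(\<Sum>k\<in>I. P i k * P j k) = P i j"
    and "(\<Sum>k\<in>I. P k i * P k j) = P i j"
    and "(\<Sum>k\<in>I. P k i * P j k) = P i j"
proof -
  show *: "(\<Sum>k\<in>I. P i k * P k j) = P i j"
    using assms unfolding projection_kernel_def by blast
  have s: "P k i = P i k" "P k j = P j k" if "k \<in> I" for k
    using that assms by (auto intro: projection_kernel_sym)
  show "(\<Sum>k\<in>I. P i k * P j k) = P i j"
    and "(\<Sum>k\<in>I. P k i * P k j) = P i j"
    and "(\<Sum>k\<in>I. P k i * P j k) = P i j"
    using * s by (simp_all cong: sum.cong)
qed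

section \<open>The fourth-order Welch inequality\<close>

lemma sum4_product:
  fixes f g h k :: "'a \<Rightarrow> real"
  shows "(\<Sum>a\<in>I. \<Sum>b\<in>I. \<Sum>c\<in>I. \<Sum>e\<in>I. f a * g b * h c * k e) = sum f I * sum g I * sum h I * sum k I"
  by (simp add: sum_distrib_left[symmetric] sum_distrib_right[symmetric])

text \<open>Keeping \<open>J\<close> apart from \<open>I\<close> gives the swap law a direction as a
  rewrite rule: it can only move \<open>J\<close> outward.\<close>

lemma sum4_swap_outer:
  fixes f :: "'b \<Rightarrow> 'a \<Rightarrow> 'a \<Rightarrow> 'a \<Rightarrow> 'a \<Rightarrow> real"
  shows "(\<Sum>a\<in>I. \<Sum>b\<in>I. \<Sum>c\<in>I. \<Sum>e\<in>I. \<Sum>i\<in>J. f i a b c e) =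
    (\<Sum>i\<in>J. \<Sum>a\<in>I. \<Sum>b\<in>I. \<Sum>c\<in>I. \<Sum>e\<in>I. f i a b c e)"
  by (simp only: sum.swap[of _ J I])

text \<open>The left-hand side is the squared norm of the 4-tensor obtained by subtracting \<open>\<gamma>\<close> times
  the symmetrization of \<open>P \<otimes> P\<close> from the sum of the fourth tensor powers of the columns of \<open>P\<close>.\<close>

lemma welch4:
  fixes P :: "'a \<Rightarrow> 'a \<Rightarrow> real"
  assumes P: "projection_kernel I P"
  defines "t \<equiv> \<Sum>i\<in>I. P i i"
  shows "0 \<le> (\<Sum>i\<in>I. \<Sum>j\<in>I. P i j ^ 4) - 6 * \<gamma> * (\<Sum>i\<in>I. (P i i)\<^sup>2) + 3 * \<gamma>\<^sup>2 * t * (t + 2)"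
proof -
  note mult = projection_kernel_mult[OF P] and sym = projection_kernel_sym[OF P]
  define S where "S f = (\<Sum>a\<in>I. \<Sum>b\<in>I. \<Sum>c\<in>I. \<Sum>e\<in>I. f a b c e)" for f :: "'a \<Rightarrow> 'a \<Rightarrow> 'a \<Rightarrow> 'a \<Rightarrow> real"
  have S_add: "S (\<lambda>a b c e. f a b c e + g a b c e) = S f + S g" for f g
    by (simp add: S_def sum.distrib)
  have S_scale: "S (\<lambda>a b c e. r * f a b c e) = r * S f" for r f
    by (simp add: S_def sum_distrib_left)
  have S_cong: "S f = S g" if "\<And>a b c e. a \<in> I \<Longrightarrow> b \<in> I \<Longrightarrow> c \<in> I \<Longrightarrow> e \<in> I \<Longrightarrow> f a b c e = g a b c e" for f g
    using that by (simp add: S_def)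
  \<comment> \<open>Permuting tensor slots leaves a full contraction unchanged, so the products with
    \<open>H2\<close> and \<open>H3\<close> reduce to products with \<open>H1\<close>.\<close>
  have S_swap: "S (\<lambda>a b c e. f a c b e) = S f" for f
    unfolding S_def by (rule sum.cong[OF refl], rule sum.swap)
  have S_swap': "S (\<lambda>a b c e. f a b e c) = S f" for f
    unfolding S_def by (rule sum.cong[OF refl], rule sum.cong[OF refl], rule sum.swap)
  \<comment> \<open>\<open>T\<close> is the sum of the fourth tensor powers; the \<open>H\<close>s
    put two copies of \<open>P\<close> on the three pairings of four slots.\<close>
  define T where "T a b c e = (\<Sum>i\<in>I. P i a * P i b * P i c * P i e)" for a b c e
  define H1 where "H1 a b c e = P a b * P c e" for a b c e
  define H2 where "H2 a b c e = P a c * P b e" for a b c e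
  define H3 where "H3 a b c e = P a e * P b c" for a b c e
  have S_sum: "S (\<lambda>a b c e. \<Sum>i\<in>J. f i a b c e) = (\<Sum>i\<in>J. S (f i))" for f :: "'a \<Rightarrow> 'a \<Rightarrow> 'a \<Rightarrow> 'a \<Rightarrow> 'a \<Rightarrow> real" and J
    unfolding S_def by (rule sum4_swap_outer)
  have TT: "S (\<lambda>a b c e. T a b c e * T a b c e) = (\<Sum>i\<in>I. \<Sum>j\<in>I. P i j ^ 4)"
  proof -
    have "S (\<lambda>a b c e. T a b c e * T a b c e) =
      S (\<lambda>a b c e. \<Sum>i\<in>I. \<Sum>j\<in>I. (P i a * P j a) * (P i b * P j b) * (P i c * P j c) * (P i e * P j e))"
      unfolding T_def sum_product by (intro S_cong sum.cong refl) (simp add: mult_ac)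
    \<comment> \<open>The four slots separate, and each contributes an entry of the square of
      \<open>P\<close>, that is, \<open>P i j\<close> itself.\<close>
    also have "\<dots> = (\<Sum>i\<in>I. \<Sum>j\<in>I. (\<Sum>a\<in>I. P i a * P j a) ^ 4)"
      unfolding S_sum by (simp add: S_def sum4_product power4_eq_xxxx)
    also have "\<dots> = (\<Sum>i\<in>I. \<Sum>j\<in>I. P i j ^ 4)"
      by (simp add: mult)
    finally show ?thesis .
  qed
  have TH1: "S (\<lambda>a b c e. T a b c e * H1 a b c e) = (\<Sum>i\<in>I. (P i i)\<^sup>2)"
  proof -
    have "S (\<lambda>a b c e. T a b c e * H1 a b c e) =
      S (\<lambda>a b c e. \<Sum>i\<in>I. (P i a * (P i b * P a b)) * (P i c * (P i e * P c e)))"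
      unfolding T_def H1_def sum_distrib_right by (simp add: mult_ac)
    also have "\<dots> = (\<Sum>i\<in>I. (P i i)\<^sup>2)"
      unfolding S_sum S_def
      by (simp add: sum_distrib_left[symmetric] sum_distrib_right[symmetric] mult power2_eq_square)
    finally show ?thesis .
  qed
  have TH2: "S (\<lambda>a b c e. T a b c e * H2 a b c e) = (\<Sum>i\<in>I. (P i i)\<^sup>2)"
    unfolding TH1[symmetric] S_swap[symmetric, of "\<lambda>a b c e. T a b c e * H1 a b c e"]
    by (rule S_cong) (simp add: T_def H1_def H2_def mult_ac)
  have TH3: "S (\<lambda>a b c e. T a b c e * H3 a b c e) = (\<Sum>i\<in>I. (P i i)\<^sup>2)"
    unfolding TH2[symmetric] S_swap'[symmetric, of "\<lambda>a b c e. T a b c e * H2 a b c e"]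
    by (rule S_cong) (simp add: T_def H2_def H3_def mult_ac)
  have H11: "S (\<lambda>a b c e. H1 a b c e * H1 a b c e) = t\<^sup>2"
  proof -
    have "S (\<lambda>a b c e. H1 a b c e * H1 a b c e) = S (\<lambda>a b c e. (P a b * P a b) * (P c e * P c e))"
      unfolding H1_def by (simp add: mult_ac)
    also have "\<dots> = t\<^sup>2"
      unfolding S_def t_def
      by (simp add: sum_distrib_left[symmetric] sum_distrib_right[symmetric] mult power2_eq_square)
    finally show ?thesis .
  qed
  have H22: "S (\<lambda>a b c e. H2 a b c e * H2 a b c e) = t\<^sup>2"
    unfolding H11[symmetric] S_swap[symmetric, of "\<lambda>a b c e. H1 a b c e * H1 a b c e"]
    by (simp add: H1_def H2_def)
  have H33: "S (\<lambda>a b c e. H3 a b c e * H3 a b c e) = t\<^sup>2"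
    unfolding H22[symmetric] S_swap'[symmetric, of "\<lambda>a b c e. H2 a b c e * H2 a b c e"]
    by (simp add: H2_def H3_def)
  \<comment> \<open>Two different pairings join the slots into one 4-cycle, giving the trace of the
    fourth power of \<open>P\<close>, hence \<open>t\<close>; a pairing against itself gives two
    2-cycles, hence \<open>t\<^sup>2\<close>.\<close>
  have H12: "S (\<lambda>a b c e. H1 a b c e * H2 a b c e) = t"
  proof -
    have "S (\<lambda>a b c e. H1 a b c e * H2 a b c e) = S (\<lambda>a b c e. P a b * (P a c * (P c e * P b e)))"
      unfolding H1_def H2_def by (simp add: mult_ac)
    also have "\<dots> = (\<Sum>a\<in>I. \<Sum>b\<in>I. P a b * (\<Sum>c\<in>I. P a c * P c b))"
      unfolding S_def by (simp add: sum_distrib_left[symmetric] mult)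
    also have "\<dots> = t"
      unfolding t_def by (simp add: mult)
    finally show ?thesis .
  qed
  have H13: "S (\<lambda>a b c e. H1 a b c e * H3 a b c e) = t"
    unfolding H12[symmetric] S_swap'[symmetric, of "\<lambda>a b c e. H1 a b c e * H2 a b c e"]
    by (rule S_cong) (simp add: H1_def H2_def H3_def sym)
  have H23: "S (\<lambda>a b c e. H2 a b c e * H3 a b c e) = t"
    unfolding H13[symmetric] S_swap[symmetric, of "\<lambda>a b c e. H1 a b c e * H3 a b c e"]
    by (rule S_cong) (simp add: H1_def H2_def H3_def sym)
  have "0 \<le> S (\<lambda>a b c e. (T a b c e - \<gamma> * (H1 a b c e + H2 a b c e + H3 a b c e))\<^sup>2)"
    unfolding S_def by (intro sum_nonneg) auto
  also have "\<dots> = S (\<lambda>a b c e. T a b c e * T a b c e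
      + ((- 2 * \<gamma>) * (T a b c e * H1 a b c e + (T a b c e * H2 a b c e + T a b c e * H3 a b c e))
      + \<gamma>\<^sup>2 * (H1 a b c e * H1 a b c e + (H2 a b c e * H2 a b c e + (H3 a b c e * H3 a b c e
      + 2 * (H1 a b c e * H2 a b c e + (H1 a b c e * H3 a b c e + H2 a b c e * H3 a b c e)))))))"
    by (rule S_cong) (simp add: power2_eq_square algebra_simps)
  also have "\<dots> = (\<Sum>i\<in>I. \<Sum>j\<in>I. P i j ^ 4) + ((- 2 * \<gamma>) * (3 * (\<Sum>i\<in>I. (P i i)\<^sup>2)) + \<gamma>\<^sup>2 * (3 * t\<^sup>2 + 6 * t))"
    unfolding S_add S_scale TT TH1 TH2 TH3 H11 H22 H33 H12 H13 H23 by simp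
  finally show ?thesis by (simp add: power2_eq_square algebra_simps)
qed

section \<open>Integrality, admissible sizes and complements\<close>

text \<open>With \<open>y = z r / (n - 2 r)\<close> one has \<open>y\<^sup>2 + z y = n - 1\<close>, so the rational number \<open>y\<close> is an integer;
  \<open>w\<close> below is the square root of the discriminant.\<close>

lemma square_integral:
  fixes z n r :: int
  assumes eq: "z\<^sup>2 * (r * (n - r)) = (n - 1) * (n - 2 * r)\<^sup>2" and ne: "n \<noteq> 2 * r"
  shows "\<exists>y. y\<^sup>2 * (n - r) = r * (n - 1)"
proof -
  define q where "q = n - 2 * r"
  have q: "q \<noteq> 0" using ne by (simp add: q_def)
  \<comment> \<open>Since \<open>n\<^sup>2 = q\<^sup>2 + 4 * (r * (n - r))\<close>, the discriminant
    is the square of the rational number \<open>z n / q\<close>, which is therefore an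
    integer.\<close>
  have "(z * n)\<^sup>2 = z\<^sup>2 * q\<^sup>2 + 4 * (z\<^sup>2 * (r * (n - r)))"
    unfolding q_def by (simp add: power2_eq_square algebra_simps)
  also have "\<dots> = q\<^sup>2 * (z\<^sup>2 + 4 * (n - 1))"
    unfolding eq q_def[symmetric] by (simp add: algebra_simps)
  finally have sq: "(z * n)\<^sup>2 = q\<^sup>2 * (z\<^sup>2 + 4 * (n - 1))" .
  then have "q\<^sup>2 dvd (z * n)\<^sup>2" by simp
  then have "q dvd z * n" by simp
  then obtain w where w: "z * n = q * w" by (elim dvdE)
  have "q\<^sup>2 * w\<^sup>2 = q\<^sup>2 * (z\<^sup>2 + 4 * (n - 1))"
    using sq unfolding w by (simp add: power_mult_distrib)
  then have w2: "w\<^sup>2 = z\<^sup>2 + 4 * (n - 1)" using q by simp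
  \<comment> \<open>The squares differ by a multiple of 4, so \<open>w\<close> and \<open>z\<close>
    have equal parity and the root \<open>(w - z) / 2\<close> is an integer.\<close>
  then have "even (w\<^sup>2) \<longleftrightarrow> even (z\<^sup>2)" by simp
  then have "even (w - z)" by simp
  then obtain y where y: "w - z = 2 * y" by (elim evenE)
  have "2 * (q * y) = 2 * (z * r)"
    using w y unfolding q_def by (simp add: algebra_simps)
  then have yq: "q * y = z * r" by simp
  have "q\<^sup>2 * (y\<^sup>2 * (n - r)) = (q * y)\<^sup>2 * (n - r)" by (simp add: power_mult_distrib)
  also have "\<dots> = r * (z\<^sup>2 * (r * (n - r)))"
    unfolding yq by (simp add: power2_eq_square algebra_simps)
  also have "\<dots> = q\<^sup>2 * (r * (n - 1))" unfolding eq q_def by simp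
  finally show ?thesis using q by auto
qed

text \<open>The diagonal of \<open>P\<^sup>2 = P\<close> fixes \<open>\<nu>\<close>; an off-diagonal
  entry then gives an integer equation for the signs, to which \<open>square_integral\<close>
  applies. When \<open>n = 2 * r\<close> that equation is trivial, so this size is a case of its
  own.\<close>

lemma equiangular_projection_size:
  fixes P :: "'a \<Rightarrow> 'a \<Rightarrow> real" and n r :: nat
  assumes P: "projection_kernel I P" and fin: "finite I" and card: "card I = n"
    and r: "1 < r" "r < n"
    and diag: "\<And>i. i \<in> I \<Longrightarrow> P i i = r / n"
    and off: "\<And>i j. i \<in> I \<Longrightarrow> j \<in> I \<Longrightarrow> i \<noteq> j \<Longrightarrow> (P i j)\<^sup>2 = \<nu>"
  shows "n = 2 * r \<or> 2 * n = r * (r + 1) \<or> 3 * n \<le> r * (r + 2)"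
proof (cases "n = 2 * r")
  case False
  have n: "1 < real n" "real r < n" "real r > 1" using r by auto
  have row: "(\<Sum>j\<in>I. f (P i j)) = f (r / n) + (\<Sum>j\<in>I-{i}. f (P i j))" if "i \<in> I" for i and f :: "real \<Rightarrow> real"
    using that fin by (simp add: sum.remove[of I i] diag)
  have cardi: "real (card (I - {i})) = real n - 1" if "i \<in> I" for i
    using that fin card r by (simp add: of_nat_diff)
  have off_sum: "(\<Sum>j\<in>I-{i}. f ((P i j)\<^sup>2)) = (real n - 1) * f \<nu>" if "i \<in> I" for i and f :: "real \<Rightarrow> real"
  proof -
    have "(\<Sum>j\<in>I-{i}. f ((P i j)\<^sup>2)) = (\<Sum>j\<in>I-{i}. f \<nu>)"
      using off that by (intro sum.cong) auto
    also have "\<dots> = (real n - 1) * f \<nu>"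
      unfolding sum_constant cardi[OF that] ..
    finally show ?thesis .
  qed
  obtain i where i: "i \<in> I" using card r by fastforce
  have "I - {i} \<noteq> {}" using i fin card r card_Diff_singleton[of i I] by (metis card.empty less_nat_zero_code zero_less_diff order.strict_trans)
  then obtain j where j: "j \<in> I" "j \<noteq> i" by blast
  \<comment> \<open>Comparing a diagonal entry of \<open>P\<^sup>2\<close> with that of
    \<open>P\<close> determines \<open>\<nu>\<close>.\<close>
  have "r / n = (\<Sum>j\<in>I. (P i j)\<^sup>2)"
    using projection_kernel_mult(2)[OF P i i] diag[OF i] by (simp add: power2_eq_square)
  also have "\<dots> = (r / n)\<^sup>2 + (real n - 1) * \<nu>"
    using row[OF i, of "\<lambda>x. x\<^sup>2"] off_sum[OF i, of "\<lambda>x. x"] by simp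
  finally have "r / n = (r / n)\<^sup>2 + (real n - 1) * \<nu>" .
  then have \<nu>: "\<nu> = r * (real n - r) / ((real n)\<^sup>2 * (real n - 1))"
    using n by (simp add: field_simps power2_eq_square)
  have \<nu>0: "\<nu> > 0" unfolding \<nu> using n by simp
  have not_square: "n \<noteq> r\<^sup>2"
  proof
    assume sq: "n = r\<^sup>2"
    then have rn: "real n = (real r)\<^sup>2" by simp
    have r1: "(real r)\<^sup>2 > 1" and r0: "real r \<noteq> 0" "real r + 1 \<noteq> 0" using n by auto
    have \<nu>': "\<nu> = 1 / ((real r)\<^sup>2 * (real r + 1))"
      unfolding \<nu> rn using r0 r1 by (subst frac_eq_eq) (simp_all, algebra)
    have S2: "(\<Sum>i\<in>I. (P i i)\<^sup>2) = 1"
      using n by (simp add: diag card rn power2_eq_square)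
    have t: "(\<Sum>i\<in>I. P i i) = r"
      using n by (simp add: diag card)
    have "(\<Sum>j\<in>I. P i j ^ 4) = (r / n) ^ 4 + (real n - 1) * \<nu>\<^sup>2" if "i \<in> I" for i
    proof -
      have "(\<Sum>j\<in>I-{i}. P i j ^ 4) = (\<Sum>j\<in>I-{i}. ((P i j)\<^sup>2)\<^sup>2)" by simp
      also have "\<dots> = (real n - 1) * \<nu>\<^sup>2" using that by (rule off_sum)
      finally show ?thesis using row[OF that, of "\<lambda>x. x ^ 4"] by simp
    qed
    then have "(\<Sum>i\<in>I. \<Sum>j\<in>I. P i j ^ 4) = n * ((r / n) ^ 4 + (real n - 1) * \<nu>\<^sup>2)"
      by (simp add: card)
    also have "\<dots> = 2 / (r * (real r + 1))"
    proof -
      have 1: "(r / real n) ^ 4 = 1 / (real r) ^ 4"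
        unfolding rn power_divide using r0 by (simp add: field_simps flip: power_mult power_add)
      have 2: "(real n - 1) * \<nu>\<^sup>2 = (real r - 1) / ((real r) ^ 4 * (real r + 1))"
        unfolding rn \<nu>' power_divide times_divide_eq_right
        using r0 by (subst frac_eq_eq) (simp_all, algebra)
      have "1 / (real r) ^ 4 = (real r + 1) / (real r ^ 4 * (real r + 1))"
        using r0 by simp
      then have 3: "1 / (real r) ^ 4 + (real r - 1) / ((real r) ^ 4 * (real r + 1)) =
          2 * r / (real r ^ 4 * (real r + 1))"
        by (simp only: add_divide_distrib[symmetric]) simp
      show ?thesis unfolding 1 2 3 unfolding rn times_divide_eq_right
        using r0 by (subst frac_eq_eq) (simp_all, algebra)
    qed
    finally have S4: "(\<Sum>i\<in>I. \<Sum>j\<in>I. P i j ^ 4) = 2 / (r * (real r + 1))" .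
    \<comment> \<open>Here the trace is \<open>r\<close> and the squared diagonal sums to 1, so the
      quadratic in \<open>\<gamma>\<close> from \<open>welch4\<close> is minimal at
      \<open>1 / (r * (r + 2))\<close>. Its value there is negative as soon as
      \<open>r > 1\<close>.\<close>
    have "0 \<le> 2 / (r * (real r + 1)) - 6 * (1 / (r * (real r + 2))) + 3 * (1 / (real r * (real r + 2)))\<^sup>2 * r * (real r + 2)"
      using welch4[OF P, of "1 / (r * (real r + 2))"] unfolding S2 S4 t by simp
    also have "\<dots> = 2 / (r * (real r + 1)) - 6 * (1 / (r * (real r + 2)))
        + 3 * ((1 / (r * (real r + 2)))\<^sup>2 * (r * (real r + 2)))"
      by (simp only: mult.assoc)
    also have "(1 / (r * (real r + 2)))\<^sup>2 * (r * (real r + 2)) = 1 / (r * (real r + 2))"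
      using r0 by (simp add: power2_eq_square)
    finally have "3 / (r * (real r + 2)) \<le> 2 / (r * (real r + 1))" by simp
    moreover have "2 * (r * (real r + 2)) < 3 * (r * (real r + 1))"
    proof -
      have "r * (2 * (real r + 2)) < r * (3 * (real r + 1))"
        using n by (intro mult_strict_left_mono) auto
      then show ?thesis by (simp add: algebra_simps)
    qed
    then have "2 / (r * (real r + 1)) < 3 / (r * (real r + 2))"
      using n by (subst frac_less_eq) (auto intro!: divide_neg_pos mult_pos_pos)
    ultimately show False by simp
  qed
  define w where "w = sqrt \<nu>"
  have w: "w > 0" "w\<^sup>2 = \<nu>" using \<nu>0 by (auto simp: w_def)
  \<comment> \<open>Only off-diagonal signs are used below; there \<open>P k l\<close> has modulus
    \<open>w > 0\<close>, so the default \<open>- 1\<close> really means a negative entry.\<close>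
  define s :: "'a \<Rightarrow> 'a \<Rightarrow> int" where "s k l = (if P k l > 0 then 1 else - 1)" for k l
  have s: "P k l = w * s k l" if "k \<in> I" "l \<in> I" "k \<noteq> l" for k l
  proof -
    have "\<bar>P k l\<bar> = w" unfolding w_def off[OF that, symmetric] by simp
    then show ?thesis using w by (auto simp: s_def)
  qed
  \<comment> \<open>This integer plays the role of \<open>z\<close> in
    \<open>square_integral\<close>.\<close>
  define y where "y = (\<Sum>k\<in>I-{i}-{j}. s i k * s k j)"
  have ij: "P i j = P j i" using i j P by (auto intro: projection_kernel_sym)
  \<comment> \<open>The summation indices \<open>i\<close> and \<open>j\<close> each contribute
    \<open>r / n\<close> times \<open>P i j\<close>; all others yield \<open>w\<^sup>2\<close> times
    an integer.\<close>
  have "P i j = (\<Sum>k\<in>I. P i k * P k j)" using projection_kernel_mult(1)[OF P] i j by simp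
  also have "\<dots> = P i i * P i j + (P i j * P j j + (\<Sum>k\<in>I-{i}-{j}. P i k * P k j))"
    using i j fin by (simp add: sum.remove[of I i] sum.remove[of "I-{i}" j])
  also have "(\<Sum>k\<in>I-{i}-{j}. P i k * P k j) = (\<Sum>k\<in>I-{i}-{j}. w\<^sup>2 * (s i k * s k j))"
    using i j by (intro sum.cong) (auto simp: s power2_eq_square)
  also have "\<dots> = w\<^sup>2 * y" unfolding y_def by (simp add: sum_distrib_left)
  finally have "w * (s i j * (1 - 2 * (r / n))) = w * (w * y)"
    using i j by (simp add: diag s power2_eq_square algebra_simps)
  then have "s i j * (1 - 2 * (r / n)) = w * y" using w by simp
  \<comment> \<open>Squaring removes the sign \<open>s i j\<close> and turns \<open>w\<close> into
    the known \<open>\<nu>\<close>.\<close>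
  then have "(s i j)\<^sup>2 * (1 - 2 * (r / n))\<^sup>2 = w\<^sup>2 * (real_of_int y)\<^sup>2"
    by (metis power_mult_distrib of_int_power)
  then have "(1 - 2 * (r / n))\<^sup>2 = \<nu> * (real_of_int y)\<^sup>2"
    unfolding w by (auto simp: s_def split: if_splits)
  moreover have "1 - 2 * (r / real n) = (real n - 2 * r) / n" using n by (simp add: field_simps)
  ultimately have "(real n - 2 * r)\<^sup>2 / (real n)\<^sup>2 = \<nu> * (real_of_int y)\<^sup>2"
    by (simp add: power_divide)
  then have "(real n - 2 * r)\<^sup>2 = (real n)\<^sup>2 * \<nu> * (real_of_int y)\<^sup>2"
    using n by (simp add: field_simps)
  also have "(real n)\<^sup>2 * \<nu> = r * (real n - r) / (real n - 1)"
    unfolding \<nu> using n by simp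
  finally have "(real_of_int y)\<^sup>2 * (r * (real n - r)) = (real n - 1) * (real n - 2 * r)\<^sup>2"
    using n by (simp add: field_simps)
  then have "real_of_int (y\<^sup>2 * (int r * (int n - int r))) = real_of_int ((int n - 1) * (int n - 2 * int r)\<^sup>2)"
    by simp
  then have "y\<^sup>2 * (int r * (int n - int r)) = (int n - 1) * (int n - 2 * int r)\<^sup>2"
    by (simp only: of_int_eq_iff)
  then obtain x where x: "x\<^sup>2 * (int n - int r) = int r * (int n - 1)"
    using square_integral[of y "int r" "int n"] False by auto
  define A where "A = x\<^sup>2"
  have A: "A * (int n - int r) = int r * (int n - 1)" using x by (simp add: A_def)
  \<comment> \<open>Strict because \<open>r > 1\<close> gives \<open>n - r < n - 1\<close>.\<close>
  have "int r * (int n - int r) < A * (int n - int r)"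
    unfolding A using r by (intro mult_strict_left_mono) auto
  then have "int r < A" using r by (simp add: mult_less_cancel_right)
  \<comment> \<open>The equation \<open>A\<close> rearranges to
    \<open>(A - r) n = r (A - 1)\<close>, from which each case is read off.\<close>
  then consider "A = int r + 1" | "A = int r + 2" | "A \<ge> int r + 3" by linarith
  then show ?thesis
  proof cases
    case 1
    then have "int n = int (r\<^sup>2)" using A by (simp add: algebra_simps power2_eq_square)
    then show ?thesis using not_square by linarith
  next
    case 2
    then have "int (2 * n) = int (r * (r + 1))" using A by (simp add: algebra_simps)
    then show ?thesis by linarith
  next
    case 3
    then have "(int r + 3) * (int n - int r) \<le> int r * (int n - 1)"
      unfolding A[symmetric] using r by (intro mult_right_mono) auto
    then have "int (3 * n) \<le> int (r * (r + 2))" by (simp add: algebra_simps)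
    then show ?thesis by linarith
  qed
qed simp

text \<open>This is the passage to the Naimark complement: the size bound applied to
  \<open>1 - P\<close> becomes a lower bound on \<open>n\<close>.\<close>

lemma projection_kernel_complement:
  assumes P: "projection_kernel I P" and fin: "finite I"
  shows "projection_kernel I (\<lambda>i j. of_bool (i = j) - P i j)"
  unfolding projection_kernel_def
proof (intro ballI conjI)
  fix i j assume ij: "i \<in> I" "j \<in> I"
  then show "of_bool (i = j) - P i j = of_bool (j = i) - P j i"
    using projection_kernel_sym[OF P] by auto
  have d: "(\<Sum>k\<in>I. of_bool (i = k) * f k) = f i" "(\<Sum>k\<in>I. f k * of_bool (k = j)) = f j" for f :: "'a \<Rightarrow> real"
    using ij fin by (simp_all add: of_bool_def if_distrib[of "\<lambda>x. x * _"] if_distrib[of "\<lambda>x. _ * x"] cong: if_cong)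
  \<comment> \<open>Grouped so that each sum over \<open>k\<close> either collapses at a Kronecker
    delta or is the square of \<open>P\<close>.\<close>
  have "(of_bool (i = k) - P i k) * (of_bool (k = j) - P k j) =
    of_bool (i = k) * (of_bool (k = j) - P k j) - P i k * of_bool (k = j) + P i k * P k j" for k
    by (simp only: left_diff_distrib right_diff_distrib)
  then show "(\<Sum>k\<in>I. (of_bool (i = k) - P i k) * (of_bool (k = j) - P k j)) = of_bool (i = j) - P i j"
    using ij by (simp only: sum.distrib sum_subtractf d projection_kernel_mult(1)[OF P])
qed

section \<open>The equality case of the Welch bound\<close>

lemma coherence_ge:
  assumes "i \<in> {1..n}" "j \<in> {1..n}" "i \<noteq> j"
  shows "\<bar>\<phi> i \<bullet> \<phi> j\<bar> \<le> coherence n \<phi>"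
proof -
  have "{\<bar>\<phi> i \<bullet> \<phi> j\<bar> | i j. i \<in> {1..n} \<and> j \<in> {1..n} \<and> i \<noteq> j} \<subseteq>
    (\<lambda>(i, j). \<bar>\<phi> i \<bullet> \<phi> j\<bar>) ` ({1..n} \<times> {1..n})" by auto
  then have "finite {\<bar>\<phi> i \<bullet> \<phi> j\<bar> | i j. i \<in> {1..n} \<and> j \<in> {1..n} \<and> i \<noteq> j}"
    by (rule finite_subset) simp
  then show ?thesis unfolding coherence_def using assms by (intro Max_ge) auto
qed

text \<open>The squared Frobenius distance of the frame operator \<open>F\<close> from
  \<open>n / d\<close> times the identity equals minus the total amount by which squared inner
  products fall short of their maximal values. Both quantities are nonnegative, so both vanish
  termwise.\<close>

lemma real_ETF_equiangular_tight:
  fixes \<phi> :: "nat \<Rightarrow> real ^ 'd"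
  assumes etf: "real_ETF n \<phi>"
  shows "\<And>i j. i \<in> {1..n} \<Longrightarrow> j \<in> {1..n} \<Longrightarrow> i \<noteq> j \<Longrightarrow>
      (\<phi> i \<bullet> \<phi> j)\<^sup>2 = (real n - CARD('d)) / (CARD('d) * (real n - 1))"
    and "\<And>a b. (\<Sum>i=1..n. \<phi> i $ a * \<phi> i $ b) = n / CARD('d) * of_bool (a = b)"
proof -
  define d where "d = CARD('d)"
  define \<nu> where "\<nu> = (real n - d) / (d * (real n - 1))"
  define F where "F a b = (\<Sum>i=1..n. \<phi> i $ a * \<phi> i $ b)" for a b
  have dn: "0 < d" "d < n" using etf by (auto simp: real_ETF_def d_def)
  have unit: "\<phi> i \<bullet> \<phi> i = 1" if "i \<in> {1..n}" for i
    using etf that by (simp add: real_ETF_def dot_square_norm)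
  have \<nu>: "0 \<le> \<nu>" using dn by (simp add: \<nu>_def)
  have le: "(\<phi> i \<bullet> \<phi> j)\<^sup>2 \<le> \<nu>" if "i \<in> {1..n}" "j \<in> {1..n}" "i \<noteq> j" for i j
  proof -
    have "\<bar>\<phi> i \<bullet> \<phi> j\<bar> \<le> sqrt \<nu>"
      using coherence_ge[OF that, of \<phi>] etf by (simp add: real_ETF_def welch_bound_def \<nu>_def d_def)
    then show ?thesis using \<nu>
      by (metis abs_ge_zero power2_abs power_mono real_sqrt_pow2)
  qed
  have inner: "\<phi> i \<bullet> \<phi> j = (\<Sum>a\<in>UNIV. \<phi> i $ a * \<phi> j $ a)" for i j
    by (simp add: inner_vec_def)
  \<comment> \<open>The frame operator and the Gram matrix have the same Frobenius norm.\<close>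
  have FF: "(\<Sum>a\<in>UNIV. \<Sum>b\<in>UNIV. (F a b)\<^sup>2) = (\<Sum>i=1..n. \<Sum>j=1..n. (\<phi> i \<bullet> \<phi> j)\<^sup>2)"
  proof -
    have "(\<Sum>a\<in>UNIV. \<Sum>b\<in>UNIV. (F a b)\<^sup>2) =
      (\<Sum>a\<in>UNIV. \<Sum>b\<in>UNIV. \<Sum>i=1..n. \<Sum>j=1..n. (\<phi> i $ a * \<phi> j $ a) * (\<phi> i $ b * \<phi> j $ b))"
      unfolding F_def power2_eq_square sum_product by (simp add: mult_ac)
    also have "\<dots> = (\<Sum>i=1..n. \<Sum>j=1..n. \<Sum>a\<in>UNIV. \<Sum>b\<in>UNIV. (\<phi> i $ a * \<phi> j $ a) * (\<phi> i $ b * \<phi> j $ b))"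
      by (simp only: sum.swap[of _ "{1..n}" UNIV])
    also have "\<dots> = (\<Sum>i=1..n. \<Sum>j=1..n. (\<phi> i \<bullet> \<phi> j)\<^sup>2)"
      by (simp add: inner power2_eq_square sum_product)
    finally show ?thesis .
  qed
  have trace: "(\<Sum>a\<in>UNIV. F a a) = n"
  proof -
    have "(\<Sum>a\<in>UNIV. F a a) = (\<Sum>i=1..n. \<phi> i \<bullet> \<phi> i)"
      unfolding F_def inner by (rule sum.swap)
    then show ?thesis using unit by simp
  qed
  define D where "D a b = F a b - n / d * of_bool (a = b)" for a b
  have "(\<Sum>a\<in>UNIV. \<Sum>b\<in>UNIV. (D a b)\<^sup>2) =
    (\<Sum>a\<in>UNIV. \<Sum>b\<in>UNIV. (F a b)\<^sup>2 + ((n / d)\<^sup>2 - 2 * (n / d) * F a a) * of_bool (a = b))"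
    unfolding D_def by (intro sum.cong refl) (auto simp: power2_eq_square algebra_simps)
  also have "\<dots> = (\<Sum>a\<in>UNIV. \<Sum>b\<in>UNIV. (F a b)\<^sup>2) + (\<Sum>a\<in>UNIV. (n / d)\<^sup>2 - 2 * (n / d) * F a a)"
    by (simp add: sum.distrib of_bool_def if_distrib[of "\<lambda>x. _ * x"] cong: if_cong)
  also have "(\<Sum>a\<in>UNIV. (n / d)\<^sup>2 - 2 * (n / d) * F a a) = - ((real n)\<^sup>2 / d)"
    unfolding sum_subtractf sum_distrib_left[symmetric] trace
    using dn by (simp add: d_def[symmetric] power2_eq_square field_simps)
  \<comment> \<open>The extremal squared Gram matrix has row sums
    \<open>1 + (n - 1) \<nu> = n / d\<close>.\<close>
  also have "(real n)\<^sup>2 / d = (\<Sum>i=1..n. \<Sum>j=1..n. if i = j then 1 else \<nu>)"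
  proof -
    have "(\<Sum>j=1..n. if i = j then 1 else \<nu>) = n / d" if "i \<in> {1..n}" for i
    proof -
      have "(\<Sum>j=1..n. if i = j then 1 else \<nu>) = (\<Sum>j=1..n. \<nu> + (if i = j then 1 - \<nu> else 0))"
        by (intro sum.cong) auto
      also have "\<dots> = n * \<nu> + (1 - \<nu>)" using that by (simp add: sum.distrib)
      also have "\<dots> = 1 + (real n - 1) * \<nu>" by (simp add: algebra_simps)
      also have "\<dots> = n / d" unfolding \<nu>_def using dn by (simp add: field_simps)
      finally show ?thesis .
    qed
    then show ?thesis by (simp add: power2_eq_square)
  qed
  finally have D: "(\<Sum>a\<in>UNIV. \<Sum>b\<in>UNIV. (D a b)\<^sup>2) =
      - (\<Sum>i=1..n. \<Sum>j=1..n. (if i = j then 1 else \<nu>) - (\<phi> i \<bullet> \<phi> j)\<^sup>2)"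
    unfolding FF by (simp add: sum_subtractf)
  have gap: "0 \<le> (if i = j then 1 else \<nu>) - (\<phi> i \<bullet> \<phi> j)\<^sup>2" if "i \<in> {1..n}" "j \<in> {1..n}" for i j
    using le[OF that] unit[OF that(1)] by auto
  have "0 \<le> (\<Sum>a\<in>UNIV. \<Sum>b\<in>UNIV. (D a b)\<^sup>2)" by (intro sum_nonneg) auto
  moreover have "0 \<le> (\<Sum>i=1..n. \<Sum>j=1..n. (if i = j then 1 else \<nu>) - (\<phi> i \<bullet> \<phi> j)\<^sup>2)"
    using gap by (intro sum_nonneg) auto
  ultimately have 0: "(\<Sum>a\<in>UNIV. \<Sum>b\<in>UNIV. (D a b)\<^sup>2) = 0"
    "(\<Sum>i=1..n. \<Sum>j=1..n. (if i = j then 1 else \<nu>) - (\<phi> i \<bullet> \<phi> j)\<^sup>2) = 0"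
    using D by linarith+
  have "D a b = 0" for a b
    using 0(1) by (simp add: sum_nonneg_eq_0_iff sum_nonneg)
  then show "(\<Sum>i=1..n. \<phi> i $ a * \<phi> i $ b) = n / CARD('d) * of_bool (a = b)" for a b
    by (simp add: D_def F_def d_def)
  fix i j assume ij: "i \<in> {1..n}" "j \<in> {1..n}" "i \<noteq> j"
  have "(\<Sum>j=1..n. (if i = j then 1 else \<nu>) - (\<phi> i \<bullet> \<phi> j)\<^sup>2) = 0"
    using 0(2) ij(1) gap by (subst (asm) sum_nonneg_eq_0_iff) (auto intro!: sum_nonneg)
  then have "(if i = j then 1 else \<nu>) - (\<phi> i \<bullet> \<phi> j)\<^sup>2 = 0"
    using ij gap by (intro sum_nonneg_0[of "{1..n}" "\<lambda>j. (if i = j then 1 else \<nu>) - (\<phi> i \<bullet> \<phi> j)\<^sup>2"]) auto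
  then show "(\<phi> i \<bullet> \<phi> j)\<^sup>2 = (real n - CARD('d)) / (CARD('d) * (real n - 1))"
    using ij by (simp add: \<nu>_def d_def)
qed

text \<open>Squaring the Gram matrix places the frame operator in the middle; by tightness it acts
  as the scalar \<open>n / d\<close>, which the factor \<open>d / n\<close> normalizes.\<close>

lemma real_ETF_projection_kernel:
  fixes \<phi> :: "nat \<Rightarrow> real ^ 'd"
  assumes etf: "real_ETF n \<phi>"
  shows "projection_kernel {1..n} (\<lambda>i j. CARD('d) / n * (\<phi> i \<bullet> \<phi> j))"
  unfolding projection_kernel_def
proof (intro ballI conjI)
  fix i j assume ij: "i \<in> {1..n}" "j \<in> {1..n}"
  show "CARD('d) / n * (\<phi> i \<bullet> \<phi> j) = CARD('d) / n * (\<phi> j \<bullet> \<phi> i)"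
    by (simp add: inner_commute)
  have "(\<Sum>k=1..n. (\<phi> i \<bullet> \<phi> k) * (\<phi> k \<bullet> \<phi> j)) =
      (\<Sum>k=1..n. \<Sum>a\<in>UNIV. \<Sum>b\<in>UNIV. \<phi> i $ a * \<phi> j $ b * (\<phi> k $ a * \<phi> k $ b))"
    by (simp add: inner_vec_def sum_product mult_ac)
  also have "\<dots> = (\<Sum>a\<in>UNIV. \<Sum>b\<in>UNIV. \<phi> i $ a * \<phi> j $ b * (\<Sum>k=1..n. \<phi> k $ a * \<phi> k $ b))"
    by (simp only: sum.swap[of _ UNIV "{1..n}"] sum_distrib_left)
  also have "\<dots> = (\<Sum>a\<in>UNIV. \<Sum>b\<in>UNIV. if a = b then n / CARD('d) * (\<phi> i $ a * \<phi> j $ a) else 0)"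
    unfolding real_ETF_equiangular_tight(2)[OF etf] by (intro sum.cong refl) auto
  also have "\<dots> = n / CARD('d) * (\<phi> i \<bullet> \<phi> j)"
    by (simp add: inner_vec_def sum_distrib_left)
  finally have gram: "(\<Sum>k=1..n. (\<phi> i \<bullet> \<phi> k) * (\<phi> k \<bullet> \<phi> j)) = n / CARD('d) * (\<phi> i \<bullet> \<phi> j)" .
  have "(\<Sum>k=1..n. CARD('d) / n * (\<phi> i \<bullet> \<phi> k) * (CARD('d) / n * (\<phi> k \<bullet> \<phi> j))) =
      (CARD('d) / n)\<^sup>2 * (\<Sum>k=1..n. (\<phi> i \<bullet> \<phi> k) * (\<phi> k \<bullet> \<phi> j))"
    by (simp add: sum_distrib_left power2_eq_square mult_ac)
  then show "(\<Sum>k=1..n. CARD('d) / n * (\<phi> i \<bullet> \<phi> k) * (CARD('d) / n * (\<phi> k \<bullet> \<phi> j))) =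
      CARD('d) / n * (\<phi> i \<bullet> \<phi> j)"
    unfolding gram using ij by (simp add: power2_eq_square)
qed

section \<open>Both bounds from the frame projection and its complement\<close>

theorem theorem1p2:
  fixes d n :: nat
    and \<phi> :: "nat \<Rightarrow> real ^ 'd"
  assumes "CARD('d) = d"
    and "d \<ge> 5"
    and "real_ETF n \<phi>"
    and "n > d + 1"
  shows "real n \<in> {real d + 1/2 + sqrt (2 * real d + 1/4), real d * (real d + 1) / 2} \<or>
         (real d + 1/2 + sqrt (3 * real d + 1/4) \<le> real n \<and>
          real n \<le> real d * (real d + 2) / 3)"
proof -
  define P where "P i j = d / n * (\<phi> i \<bullet> \<phi> j)" for i j
  define Q where "Q i j = of_bool (i = j) - P i j" for i j
  define m where "m = n - d"
  define \<nu> where "\<nu> = (d / n)\<^sup>2 * ((real n - d) / (d * (real n - 1)))"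
  have n: "n = d + m" "1 < m" "m < n" "1 < d" "d < n" using assms(2,4) by (auto simp: m_def)
  have P: "projection_kernel {1..n} P"
    using real_ETF_projection_kernel[OF assms(3)] unfolding P_def assms(1) .
  have Q: "projection_kernel {1..n} Q"
    unfolding Q_def by (rule projection_kernel_complement[OF P]) simp
  have diag: "P i i = d / n" if "i \<in> {1..n}" for i
    using assms(3) that by (simp add: P_def real_ETF_def dot_square_norm)
  have off: "(P i j)\<^sup>2 = \<nu>" if "i \<in> {1..n}" "j \<in> {1..n}" "i \<noteq> j" for i j
    unfolding P_def power_mult_distrib real_ETF_equiangular_tight(1)[OF assms(3) that] \<nu>_def assms(1) ..
  have diagQ: "Q i i = m / n" if "i \<in> {1..n}" for i
    using n that by (simp add: Q_def diag field_simps)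
  have offQ: "(Q i j)\<^sup>2 = \<nu>" if "i \<in> {1..n}" "j \<in> {1..n}" "i \<noteq> j" for i j
    using off[OF that] that by (simp add: Q_def)
  have sizeP: "n = 2 * d \<or> 2 * n = d * (d + 1) \<or> 3 * n \<le> d * (d + 2)"
    using n diag off by (intro equiangular_projection_size[OF P]) auto
  have sizeQ: "n = 2 * m \<or> 2 * n = m * (m + 1) \<or> 3 * n \<le> m * (m + 2)"
    using n diagQ offQ by (intro equiangular_projection_size[OF Q]) auto
  \<comment> \<open>Completing the square: \<open>m * (m - 1) + 1 / 4\<close> is the square of
    \<open>m - 1 / 2\<close>. The values needed are \<open>2 * d\<close> and
    \<open>3 * d\<close>.\<close>
  have root: "sqrt (c + 1 / 4) = m - 1 / 2" if "real m * (real m - 1) = c" for c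
    using n that by (intro real_sqrt_unique) (auto simp: power2_eq_square algebra_simps)
  have root_le: "sqrt (c + 1 / 4) \<le> m - 1 / 2" if "c \<le> real m * (real m - 1)" for c
    using n that by (intro real_le_lsqrt) (auto simp: power2_eq_square algebra_simps)
  have rn: "real n = real d + real m" using n by simp
  show ?thesis
  proof (cases "n = 2 * d")
    case True
    then have "m = d" using n by simp
    \<comment> \<open>The exceptional size \<open>n = 2 * d\<close> satisfies both bounds, since
      \<open>d \<ge> 5\<close> gives \<open>d - 1 \<ge> 4\<close> and
      \<open>d + 2 \<ge> 6\<close>.\<close>
    moreover have "real d * 4 \<le> real d * (real d - 1)" "real d * 6 \<le> real d * (real d + 2)"
      using assms(2) by (auto intro!: mult_left_mono)
    ultimately show ?thesis using root_le[of "3 * d"] rn by simp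
  next
    case False
    \<comment> \<open>As \<open>n = d + m\<close>, excluding \<open>n = 2 * d\<close> also excludes
      \<open>n = 2 * m\<close>.\<close>
    consider "2 * n = d * (d + 1)" | "2 * n = m * (m + 1)"
      | "3 * n \<le> d * (d + 2)" "3 * n \<le> m * (m + 2)"
      using sizeP sizeQ False n by auto
    then show ?thesis
    proof cases
      case 1
      then have "real (2 * n) = real (d * (d + 1))" by (simp only:)
      then have "real n = real d * (real d + 1) / 2" by (simp add: algebra_simps)
      then show ?thesis by blast
    next
      case 2
      then have "real (2 * n) = real (m * (m + 1))" by (simp only:)
      then have "real m * (real m - 1) = 2 * d" using rn by (simp add: algebra_simps)
      then show ?thesis using root[of "2 * d"] rn by simp
    next
      case 3
      then have "real (3 * n) \<le> real (d * (d + 2))" "real (3 * n) \<le> real (m * (m + 2))"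
        by (simp_all only: of_nat_le_iff)
      \<comment> \<open>Substituting \<open>n = d + m\<close> turns the bound for the complement
        into a quadratic condition on \<open>m\<close>.\<close>
      then have "3 * d \<le> real m * (real m - 1)" "real n \<le> d * (real d + 2) / 3"
        using rn by (simp_all add: algebra_simps)
      then show ?thesis using root_le[of "3 * d"] rn by simp
    qed
  qed
qed

end
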